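(* Consider the perturbed Kagome lattice with fixed vertex weight $\mu>0$ and periodic edge weights $\gamma_1,\dots,\gamma_6>0$ satisfying the constant vertex weight condition $$\gamma_1+\gamma_3+\gamma_4+\gamma_6=\gamma_2+\gamma_3+\gamma_5+\gamma_6=\gamma_1+\gamma_2+\gamma_4+\gamma_5=\mu,$$ and with Laplacian $(\Delta_\gamma f)(v)=f(v)-\frac1\mu\sum_{w\sim v}\gamma_{vw}f(w)$ on $\ell^2(V)$. Then the following are equivalent: (i) $\Delta_\gamma$ has a flat band. (ii) The edge weights are monomeric. More explicitly, there are $\alpha,\beta>0$ with $2(\alpha+\beta)=\mu$ such that $\gamma_2=\gamma_4=\gamma_6=\alpha$ and $\gamma_1=\gamma_3=\gamma_5=\beta$.
   Context: The Kagome lattice is the Archimedean tiling in which every vertex is surrounded cyclically by triangle, hexagon, triangle, hexagon. As a graph with periodic edge weights it is described as follows. The vertex set is $V=\{v_j+\beta : j\in\{1,2,3\},\ \beta\in\mathbb{Z}^2\}$ (disjoint translates of three vertices), with translations $T_{\beta'}(v_j+\beta)=v_j+\beta+\beta'$; write $\omega_1=(1,0)$, $\omega_2=(0,1)$. The edges are the $\mathbb{Z}^2$-translates of the following six edges, with the weights indicated (symmetric and constant along translates): $v_1\sim v_3+\omega_2$ (weight $\gamma_1$), $v_2\sim v_3$ (weight $\gamma_2$), $v_1\sim v_2$ (weight $\gamma_3$), $v_1\sim v_3+\omega_1$ (weight $\gamma_4$), $v_2\sim v_3+\omega_2$ (weight $\gamma_5$), $v_1\sim v_2+\omega_1$ (weight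 $\gamma_6$). The edges with weights $\gamma_2,\gamma_4,\gamma_6$ form the triangles of one orientation and those with weights $\gamma_1,\gamma_3,\gamma_5$ the triangles of the other orientation. The condition in the claim says that $\sum_{w\sim v}\gamma_{vw}=\mu$ for every $v\in V$. The edge weights are monomeric if for all $v\in V$ the list of edge weights, arranged cyclically around $v$ in the planar tiling, coincides up to cyclic permutations. Flat bands: for $\theta\in\mathbb{R}^2$ let $\ell^2(V)_\theta=\{f:V\to\mathbb{C}: f(T_\beta v)=e^{i\langle\theta,\beta\rangle}f(v)\ \text{for all } v,\beta\}$ (3-dimensional) and let $\Delta_\gamma^\theta$ be the operator on $\ell^2(V)_\theta$ given by the same formula as $\Delta_\gamma$. With $w=e^{i\theta_1}$, $z=e^{i\theta_2}$ it is represented by $$\Delta_\gamma^\theta=\mathrm{Id}-\frac1\mu\begin{pmatrix}0&\gamma_3+w\gamma_6&w\gamma_4+z\gamma_1\\ \gamma_3+\overline w\gamma_6&0&\gamma_2+z\gamma_5\\ \overline w\gamma_4+\overline z\gamma_1&\gamma_2+\overline z\gamma_5&0\end{pmatrix}.$$ $\Delta_\gamma$ has a flat band at energy $E\in\mathbb{R}$ if $E\in\sigma(\Delta_\gamma^\theta)$ for all $\theta$ (equivalently, there is an infinite orthonormal family of eigenfunctions of $\Delta_\gamma$ in $\ell^2(V)$ to the eigenvalue $E$).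
   Formalization: Condition (ii) is taken as "monomeric and the explicit α, β condition": monomeric alone (lists equal up to cyclic permutation) does not imply a flat band, e.g. γ2=γ3=γ4=a, γ1=γ5=γ6=b with a≠b, so the explicit form is required and not derived from monomeric. *)

theory Defs
  imports "HOL-Analysis.Analysis"
begin

datatype site = V1 | V2 | V3

type_synonym vertex = "site \<times> (int \<times> int)"

abbreviation \<omega>1 :: "int \<times> int" where "\<omega>1 \<equiv> (1, 0)"
abbreviation \<omega>2 :: "int \<times> int" where "\<omega>2 \<equiv> (0, 1)"

definition translate :: "int \<times> int \<Rightarrow> vertex \<Rightarrow> vertex"
  where "translate \<beta> v = (fst v, snd v + \<beta>)"

text \<open>The index \<open>k\<close> of an edge names its weight \<open>\<gamma> k\<close>.\<close>

inductive kagome_arc :: "nat \<Rightarrow> vertex \<Rightarrow> vertex \<Rightarrow> bool"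
where
  "kagome_arc 1 (V1, \<beta>) (V3, \<beta> + \<omega>2)"
| "kagome_arc 2 (V2, \<beta>) (V3, \<beta>)"
| "kagome_arc 3 (V1, \<beta>) (V2, \<beta>)"
| "kagome_arc 4 (V1, \<beta>) (V3, \<beta> + \<omega>1)"
| "kagome_arc 5 (V2, \<beta>) (V3, \<beta> + \<omega>2)"
| "kagome_arc 6 (V1, \<beta>) (V2, \<beta> + \<omega>1)"

definition kagome_edge :: "nat \<Rightarrow> vertex \<Rightarrow> vertex \<Rightarrow> bool"
  where "kagome_edge k v w \<longleftrightarrow> kagome_arc k v w \<or> kagome_arc k w v"

definition neighbours :: "vertex \<Rightarrow> vertex set"
  where "neighbours v = {w. \<exists>k. kagome_edge k v w}"

text \<open>Only meaningful for adjacent vertices; by \<open>kagome_edge_unique\<close> below the index is unique.\<close>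

definition edge_weight :: "(nat \<Rightarrow> real) \<Rightarrow> vertex \<Rightarrow> vertex \<Rightarrow> real"
  where "edge_weight \<gamma> v w = \<gamma> (THE k. kagome_edge k v w)"

definition laplacian ::
    "real \<Rightarrow> (nat \<Rightarrow> real) \<Rightarrow> (vertex \<Rightarrow> complex) \<Rightarrow> vertex \<Rightarrow> complex"
  where "laplacian \<mu> \<gamma> f v =
    f v - 1 / of_real \<mu> * (\<Sum>w\<in>neighbours v. of_real (edge_weight \<gamma> v w) * f w)"

text \<open>The three-dimensional space \<open>\<ell>\<^sup>2(V)\<^sub>\<theta>\<close> of \<open>\<theta>\<close>-quasiperiodic functions.\<close>

definition bloch_space :: "real \<times> real \<Rightarrow> (vertex \<Rightarrow> complex) set"
  where "bloch_space \<theta> = {f. \<forall>\<beta> v. f (translate \<beta> v) =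
    exp (\<i> * of_real (fst \<theta> * of_int (fst \<beta>) + snd \<theta> * of_int (snd \<beta>))) * f v}"

text \<open>The spectrum of a linear operator \<open>T\<close> on the finite-dimensional invariant space \<open>S\<close>.\<close>

definition spectrum_on ::
    "(vertex \<Rightarrow> complex) set \<Rightarrow> ((vertex \<Rightarrow> complex) \<Rightarrow> vertex \<Rightarrow> complex) \<Rightarrow> complex set"
  where "spectrum_on S T = {E. \<not> bij_betw (\<lambda>f v. T f v - E * f v) S S}"

definition has_flat_band :: "real \<Rightarrow> (nat \<Rightarrow> real) \<Rightarrow> bool"
  where "has_flat_band \<mu> \<gamma> \<longleftrightarrow>
    (\<exists>E::real. \<forall>\<theta>. of_real E \<in> spectrum_on (bloch_space \<theta>) (laplacian \<mu> \<gamma>))"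

text \<open>The planar tiling: \<open>\<omega>1\<close> and \<open>\<omega>2\<close> act as the translations by \<open>2\<close> and \<open>2 * cis (pi / 3)\<close>, and
  all edges have length \<open>1\<close>.\<close>

fun tiling_position :: "vertex \<Rightarrow> complex"
  where "tiling_position (s, (m, n)) = 2 * of_int m + 2 * of_int n * cis (pi / 3) +
    (case s of V1 \<Rightarrow> 1 + cis (pi / 3) | V2 \<Rightarrow> cis (pi / 3) | V3 \<Rightarrow> 0)"

text \<open>The neighbours of a vertex in counterclockwise order in this tiling
  (see \<open>neighbours_ccw_angles\<close> below).\<close>

fun neighbours_ccw :: "vertex \<Rightarrow> vertex list"
where
  "neighbours_ccw (V1, \<beta>) = [(V3, \<beta> + \<omega>2), (V2, \<beta>), (V3, \<beta> + \<omega>1), (V2, \<beta> + \<omega>1)]"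
| "neighbours_ccw (V2, \<beta>) = [(V1, \<beta>), (V3, \<beta> + \<omega>2), (V1, \<beta> - \<omega>1), (V3, \<beta>)]"
| "neighbours_ccw (V3, \<beta>) = [(V2, \<beta> - \<omega>2), (V1, \<beta> - \<omega>2), (V2, \<beta>), (V1, \<beta> - \<omega>1)]"

text \<open>For \<open>a \<noteq> b\<close> the weights \<open>\<gamma> 2 = \<gamma> 3 = \<gamma> 4 = a\<close>, \<open>\<gamma> 1 = \<gamma> 5 = \<gamma> 6 = b\<close> are monomeric in this
  sense, but not constant on the triangles of either orientation
  (see \<open>monomeric_not_imp_constant\<close> below).\<close>

definition monomeric :: "(nat \<Rightarrow> real) \<Rightarrow> bool"
  where "monomeric \<gamma> \<longleftrightarrow>
    (\<forall>v v'. \<exists>n. map (edge_weight \<gamma> v') (neighbours_ccw v') =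
                rotate n (map (edge_weight \<gamma> v) (neighbours_ccw v)))"

lemma kagome_edge_V1:
  "kagome_edge k (V1, \<beta>) w \<longleftrightarrow>
    (k = 1 \<and> w = (V3, \<beta> + \<omega>2)) \<or> (k = 3 \<and> w = (V2, \<beta>)) \<or>
    (k = 4 \<and> w = (V3, \<beta> + \<omega>1)) \<or> (k = 6 \<and> w = (V2, \<beta> + \<omega>1))"
  by (auto simp: kagome_edge_def kagome_arc.simps)

lemma kagome_edge_V2:
  "kagome_edge k (V2, \<beta>) w \<longleftrightarrow>
    (k = 3 \<and> w = (V1, \<beta>)) \<or> (k = 5 \<and> w = (V3, \<beta> + \<omega>2)) \<or>
    (k = 6 \<and> w = (V1, \<beta> - \<omega>1)) \<or> (k = 2 \<and> w = (V3, \<beta>))"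
  by (cases w) (auto simp: kagome_edge_def kagome_arc.simps algebra_simps)

lemma kagome_edge_V3:
  "kagome_edge k (V3, \<beta>) w \<longleftrightarrow>
    (k = 5 \<and> w = (V2, \<beta> - \<omega>2)) \<or> (k = 1 \<and> w = (V1, \<beta> - \<omega>2)) \<or>
    (k = 2 \<and> w = (V2, \<beta>)) \<or> (k = 4 \<and> w = (V1, \<beta> - \<omega>1))"
  by (cases w) (auto simp: kagome_edge_def kagome_arc.simps algebra_simps)

lemmas kagome_edge_simps = kagome_edge_V1 kagome_edge_V2 kagome_edge_V3

lemma kagome_edge_unique:
  assumes "kagome_edge k v w" and "kagome_edge l v w"
  shows "k = l"
proof -
  obtain s m n where "v = (s, (m, n))" by (metis surj_pair)
  with assms show ?thesis
    by (cases s) (auto simp: kagome_edge_simps)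
qed

lemma edge_weight_eqI: "kagome_edge k v w \<Longrightarrow> edge_weight \<gamma> v w = \<gamma> k"
  unfolding edge_weight_def using kagome_edge_unique by (metis the_equality)

lemma set_neighbours_ccw: "set (neighbours_ccw v) = neighbours v"
proof (rule set_eqI)
  show "w \<in> set (neighbours_ccw v) \<longleftrightarrow> w \<in> neighbours v" for w
    by (cases v rule: neighbours_ccw.cases)
      (simp_all add: neighbours_def kagome_edge_simps ex_disj_distrib)
qed

lemma distinct_neighbours_ccw: "distinct (neighbours_ccw v)"
  by (cases v rule: neighbours_ccw.cases) (auto simp: zero_prod_def)

lemma map_edge_weight:
  "map (edge_weight \<gamma> (V1, \<beta>)) (neighbours_ccw (V1, \<beta>)) = [\<gamma> 1, \<gamma> 3, \<gamma> 4, \<gamma> 6]"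
  "map (edge_weight \<gamma> (V2, \<beta>)) (neighbours_ccw (V2, \<beta>)) = [\<gamma> 3, \<gamma> 5, \<gamma> 6, \<gamma> 2]"
  "map (edge_weight \<gamma> (V3, \<beta>)) (neighbours_ccw (V3, \<beta>)) = [\<gamma> 5, \<gamma> 1, \<gamma> 2, \<gamma> 4]"
  by (auto intro!: edge_weight_eqI simp: kagome_edge_simps)

text \<open>From each listed neighbour to the next one turns left through a triangle, a hexagon, a
  triangle and a hexagon.\<close>

lemma neighbours_ccw_angles:
  assumes "neighbours_ccw v = [a, b, c, d]"
  defines "dir \<equiv> \<lambda>w. tiling_position w - tiling_position v"
  shows "cmod (dir a) = 1" "dir b = cis (pi / 3) * dir a" "dir c = cis (2 * pi / 3) * dir b"
    "dir d = cis (pi / 3) * dir c" "dir a = cis (2 * pi / 3) * dir d"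
proof -
  define u where "u = cis (pi / 3)"
  have u: "u = Complex (1 / 2) (sqrt 3 / 2)"
    by (simp add: u_def cis.ctr cos_60 sin_60)
  have u2: "u * u = u - 1"
    by (simp add: u complex_eq_iff)
  have u3: "u * (u - 1) = - 1" "(u - 1) * u = - 1" "u * (1 - u) = 1"
      "(u - 1) * (u - 1) = - u" "(u - 1) * (1 - u) = u"
    using u2 by (simp_all add: algebra_simps)
  have cis2: "cis (2 * pi / 3) = u - 1"
    by (simp add: u2[symmetric]) (simp add: u_def cis_mult)
  have norms: "cmod u = 1" "cmod (u - 1) = 1"
    by (simp add: u_def) (simp add: cis2[symmetric])
  obtain s m n where v: "v = (s, (m, n))" by (metis surj_pair)
  have dir: "(s = V1 \<and> dir a = u - 1 \<and> dir b = - 1 \<and> dir c = 1 - u \<and> dir d = 1) \<or>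
    (s = V2 \<and> dir a = 1 \<and> dir b = u \<and> dir c = - 1 \<and> dir d = - u) \<or>
    (s = V3 \<and> dir a = - u \<and> dir b = 1 - u \<and> dir c = u \<and> dir d = u - 1)"
    using assms(1) unfolding v dir_def
    by (cases s) (auto simp flip: u_def simp: algebra_simps)
  show "cmod (dir a) = 1" "dir b = cis (pi / 3) * dir a" "dir c = cis (2 * pi / 3) * dir b"
    "dir d = cis (pi / 3) * dir c" "dir a = cis (2 * pi / 3) * dir d"
    using dir unfolding cis2 u_def[symmetric]
    by (elim disjE; simp add: norms u3 u2)+
qed

lemma laplacian_sum_list:
  "laplacian \<mu> \<gamma> f v =
    f v - 1 / of_real \<mu> * (\<Sum>w\<leftarrow>neighbours_ccw v. of_real (edge_weight \<gamma> v w) * f w)"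
  by (simp add: laplacian_def sum_list_distinct_conv_sum_set[OF distinct_neighbours_ccw]
      set_neighbours_ccw)

lemma laplacian_bloch:
  assumes f: "f \<in> bloch_space (\<theta>1, \<theta>2)"
  defines "w \<equiv> cis \<theta>1" and "z \<equiv> cis \<theta>2"
    and "x1 \<equiv> f (V1, (0, 0))" and "x2 \<equiv> f (V2, (0, 0))" and "x3 \<equiv> f (V3, (0, 0))"
  shows "laplacian \<mu> \<gamma> f (V1, (0, 0)) =
      x1 - 1 / of_real \<mu> * ((of_real (\<gamma> 3) + w * of_real (\<gamma> 6)) * x2 + (w * of_real (\<gamma> 4) + z * of_real (\<gamma> 1)) * x3)"
    and "laplacian \<mu> \<gamma> f (V2, (0, 0)) =
      x2 - 1 / of_real \<mu> * ((of_real (\<gamma> 3) + cnj w * of_real (\<gamma> 6)) * x1 + (of_real (\<gamma> 2) + z * of_real (\<gamma> 5)) * x3)"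
    and "laplacian \<mu> \<gamma> f (V3, (0, 0)) =
      x3 - 1 / of_real \<mu> * ((cnj w * of_real (\<gamma> 4) + cnj z * of_real (\<gamma> 1)) * x1 + (of_real (\<gamma> 2) + cnj z * of_real (\<gamma> 5)) * x2)"
proof -
  have shift: "f (s, (m, n)) = exp (\<i> * of_real (\<theta>1 * of_int m + \<theta>2 * of_int n)) * f (s, (0, 0))"
    for s m n
    using f[unfolded bloch_space_def, simplified, rule_format, of m n s 0 0]
    by (simp add: translate_def)
  have ws: "w = exp (\<i> * of_real \<theta>1)" "z = exp (\<i> * of_real \<theta>2)"
    "cnj w = exp (- (\<i> * of_real \<theta>1))" "cnj z = exp (- (\<i> * of_real \<theta>2))"
    by (simp_all add: w_def z_def cis_conv_exp exp_cnj)
  have t: "f (s, (1, 0)) = w * f (s, (0, 0))" "f (s, (0, 1)) = z * f (s, (0, 0))"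
    "f (s, (- 1, 0)) = cnj w * f (s, (0, 0))" "f (s, (0, - 1)) = cnj z * f (s, (0, 0))" for s
    unfolding ws(3,4) unfolding ws(1,2)
    using shift[of s 1 0] shift[of s 0 1] shift[of s "- 1" 0] shift[of s 0 "- 1"]
    by simp_all
  have c: "laplacian \<mu> \<gamma> f v = f v - 1 / of_real \<mu> *
      (of_real k1 * f w1 + of_real k2 * f w2 + of_real k3 * f w3 + of_real k4 * f w4)"
    if "neighbours_ccw v = [w1, w2, w3, w4]"
      "map (edge_weight \<gamma> v) (neighbours_ccw v) = [k1, k2, k3, k4]"
    for v w1 w2 w3 w4 k1 k2 k3 k4
    using that by (simp add: laplacian_sum_list add.assoc)
  have n: "neighbours_ccw (V1, (0, 0)) = [(V3, (0, 1)), (V2, (0, 0)), (V3, (1, 0)), (V2, (1, 0))]"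
    "neighbours_ccw (V2, (0, 0)) = [(V1, (0, 0)), (V3, (0, 1)), (V1, (- 1, 0)), (V3, (0, 0))]"
    "neighbours_ccw (V3, (0, 0)) = [(V2, (0, - 1)), (V1, (0, - 1)), (V2, (0, 0)), (V1, (- 1, 0))]"
    by simp_all
  show "laplacian \<mu> \<gamma> f (V1, (0, 0)) =
      x1 - 1 / of_real \<mu> * ((of_real (\<gamma> 3) + w * of_real (\<gamma> 6)) * x2 + (w * of_real (\<gamma> 4) + z * of_real (\<gamma> 1)) * x3)"
    unfolding c[OF n(1) map_edge_weight(1)] t x1_def x2_def x3_def
    by (simp only: distrib_left distrib_right ac_simps)
  show "laplacian \<mu> \<gamma> f (V2, (0, 0)) =
      x2 - 1 / of_real \<mu> * ((of_real (\<gamma> 3) + cnj w * of_real (\<gamma> 6)) * x1 + (of_real (\<gamma> 2) + z * of_real (\<gamma> 5)) * x3)"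
    unfolding c[OF n(2) map_edge_weight(2)] t x1_def x2_def x3_def
    by (simp only: distrib_left distrib_right ac_simps)
  show "laplacian \<mu> \<gamma> f (V3, (0, 0)) =
      x3 - 1 / of_real \<mu> * ((cnj w * of_real (\<gamma> 4) + cnj z * of_real (\<gamma> 1)) * x1 + (of_real (\<gamma> 2) + cnj z * of_real (\<gamma> 5)) * x2)"
    unfolding c[OF n(3) map_edge_weight(3)] t x1_def x2_def x3_def
    by (simp only: distrib_left distrib_right ac_simps)
qed

lemma monomericI:
  assumes "\<And>xs ys. xs \<in> S \<Longrightarrow> ys \<in> S \<Longrightarrow> \<exists>n. xs = rotate n ys"
    and "[\<gamma> 1, \<gamma> 3, \<gamma> 4, \<gamma> 6] \<in> S" and "[\<gamma> 3, \<gamma> 5, \<gamma> 6, \<gamma> 2] \<in> S" and "[\<gamma> 5, \<gamma> 1, \<gamma> 2, \<gamma> 4] \<in> S"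
  shows "monomeric \<gamma>"
proof -
  have "map (edge_weight \<gamma> v) (neighbours_ccw v) \<in> S" for v
    using assms(2-4) by (metis map_edge_weight neighbours_ccw.cases)
  with assms(1) show ?thesis unfolding monomeric_def by blast
qed

lemma constant_imp_monomeric:
  assumes "\<gamma> 2 = \<alpha>" "\<gamma> 4 = \<alpha>" "\<gamma> 6 = \<alpha>" "\<gamma> 1 = \<beta>" "\<gamma> 3 = \<beta>" "\<gamma> 5 = \<beta>"
  shows "monomeric \<gamma>"
proof (rule monomericI[where S = "{[\<beta>, \<beta>, \<alpha>, \<alpha>]}"])
  show "\<exists>n. xs = rotate n ys" if "xs \<in> {[\<beta>, \<beta>, \<alpha>, \<alpha>]}" "ys \<in> {[\<beta>, \<beta>, \<alpha>, \<alpha>]}" for xs ys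
    using that by (intro exI[of _ 0]) auto
qed (simp_all only: assms singleton_iff)

lemma monomeric_not_imp_constant:
  fixes a b :: real
  assumes "a \<noteq> b"
  defines "\<gamma> \<equiv> (\<lambda>k::nat. if k \<in> {2, 3, 4} then a else b)"
  shows "monomeric \<gamma>" and "\<not> (\<gamma> 2 = \<gamma> 4 \<and> \<gamma> 4 = \<gamma> 6)" and "\<not> (\<gamma> 1 = \<gamma> 3 \<and> \<gamma> 3 = \<gamma> 5)"
proof -
  have w: "\<gamma> 1 = b" "\<gamma> 2 = a" "\<gamma> 3 = a" "\<gamma> 4 = a" "\<gamma> 5 = b" "\<gamma> 6 = b"
    by (simp_all add: \<gamma>_def)
  show "monomeric \<gamma>"
  proof (rule monomericI[where S = "range (\<lambda>n. rotate n [a, a, b, b])"])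
    fix xs ys assume "xs \<in> range (\<lambda>n. rotate n [a, a, b, b])" "ys \<in> range (\<lambda>n. rotate n [a, a, b, b])"
    then obtain k l where xs: "xs = rotate k [a, a, b, b]" and ys: "ys = rotate l [a, a, b, b]"
      by auto
    have "rotate (k + 3 * l) ys = rotate (k + 4 * l) [a, a, b, b]"
      by (simp add: ys rotate_rotate ac_simps)
    also have "\<dots> = xs"
      unfolding xs by (subst (1 2) rotate_conv_mod) simp
    finally show "\<exists>n. xs = rotate n ys" by metis
  next
    show "[\<gamma> 1, \<gamma> 3, \<gamma> 4, \<gamma> 6] \<in> range (\<lambda>n. rotate n [a, a, b, b])"
      unfolding w by (rule range_eqI[of _ _ 3]) (simp add: numeral_eq_Suc)
    show "[\<gamma> 3, \<gamma> 5, \<gamma> 6, \<gamma> 2] \<in> range (\<lambda>n. rotate n [a, a, b, b])"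
      unfolding w by (rule range_eqI[of _ _ 1]) (simp add: numeral_eq_Suc)
    show "[\<gamma> 5, \<gamma> 1, \<gamma> 2, \<gamma> 4] \<in> range (\<lambda>n. rotate n [a, a, b, b])"
      unfolding w by (rule range_eqI[of _ _ 2]) (simp add: numeral_eq_Suc)
  qed
  show "\<not> (\<gamma> 2 = \<gamma> 4 \<and> \<gamma> 4 = \<gamma> 6)" and "\<not> (\<gamma> 1 = \<gamma> 3 \<and> \<gamma> 3 = \<gamma> 5)"
    using assms(1) w by auto
qed

end

theory Submission
  imports Defs
begin

text \<open>On the \<open>\<theta>\<close>-quasiperiodic functions \<open>\<Delta> - E\<close> is a 3 by 3 matrix, so \<open>E\<close> is a flat band iff its
  determinant, a trigonometric polynomial in \<open>\<theta>\<close> with frequencies \<open>0, \<theta>\<^sub>1, \<theta>\<^sub>2, \<theta>\<^sub>1 - \<theta>\<^sub>2\<close>, vanishes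
  identically. The constant vertex weight condition is equivalent to
  \<open>\<gamma>\<^sub>1 + \<gamma>\<^sub>4 = \<gamma>\<^sub>2 + \<gamma>\<^sub>5 = \<gamma>\<^sub>3 + \<gamma>\<^sub>6 = \<mu> / 2\<close>, which leaves the unknowns \<open>\<gamma>\<^sub>2, \<gamma>\<^sub>4, \<gamma>\<^sub>6\<close> and \<open>p = \<mu> (E - 1)\<close>;
  the three nonconstant coefficients then give equations whose only positive solutions have
  \<open>\<gamma>\<^sub>2 = \<gamma>\<^sub>4 = \<gamma>\<^sub>6\<close>. Conversely, for such weights the determinant vanishes identically at \<open>E = 3 / 2\<close>.\<close>

definition bloch_phase :: "real \<times> real \<Rightarrow> int \<times> int \<Rightarrow> complex"
  where "bloch_phase \<theta> \<beta> = cis (fst \<theta> * of_int (fst \<beta>) + snd \<theta> * of_int (snd \<beta>))"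

lemma bloch_phase_zero [simp]: "bloch_phase \<theta> (0, 0) = 1"
  by (simp add: bloch_phase_def)

lemma bloch_phase_add: "bloch_phase \<theta> (\<beta> + \<beta>') = bloch_phase \<theta> \<beta> * bloch_phase \<theta> \<beta>'"
  by (simp add: bloch_phase_def cis_mult algebra_simps)

lemma bloch_space_iff:
  "f \<in> bloch_space \<theta> \<longleftrightarrow> (\<forall>s \<beta> \<beta>'. f (s, \<beta> + \<beta>') = bloch_phase \<theta> \<beta>' * f (s, \<beta>))"
  by (auto simp: bloch_space_def translate_def bloch_phase_def cis_conv_exp)

lemma bloch_space_iff_origin:
  "f \<in> bloch_space \<theta> \<longleftrightarrow> (\<forall>s \<beta>. f (s, \<beta>) = bloch_phase \<theta> \<beta> * f (s, (0, 0)))"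
proof
  assume "f \<in> bloch_space \<theta>"
  then show "\<forall>s \<beta>. f (s, \<beta>) = bloch_phase \<theta> \<beta> * f (s, (0, 0))"
    unfolding bloch_space_iff by (metis add_0 zero_prod_def)
next
  assume *: "\<forall>s \<beta>. f (s, \<beta>) = bloch_phase \<theta> \<beta> * f (s, (0, 0))"
  show "f \<in> bloch_space \<theta>"
    unfolding bloch_space_iff
  proof (intro allI)
    fix s \<beta> \<beta>'
    show "f (s, \<beta> + \<beta>') = bloch_phase \<theta> \<beta>' * f (s, \<beta>)"
      using *[rule_format, of s "\<beta> + \<beta>'"] *[rule_format, of s \<beta>] by (simp add: bloch_phase_add)
  qed
qed

definition cell_values :: "(vertex \<Rightarrow> complex) \<Rightarrow> complex ^ 3"
  where "cell_values f = vector [f (V1, (0, 0)), f (V2, (0, 0)), f (V3, (0, 0))]"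

text \<open>Quasiperiodicity determines a function from one value per translation orbit and leaves
  these values free, so the three values in the cell at the origin serve as coordinates.\<close>

lemma bij_betw_cell_values: "bij_betw cell_values (bloch_space \<theta>) UNIV"
proof (rule bij_betw_imageI)
  show "inj_on cell_values (bloch_space \<theta>)"
  proof (rule inj_onI, rule ext)
    fix f g :: "vertex \<Rightarrow> complex" and v :: vertex
    assume fg: "f \<in> bloch_space \<theta>" "g \<in> bloch_space \<theta>" "cell_values f = cell_values g"
    obtain s \<beta> where v: "v = (s, \<beta>)" by (cases v)
    have "f (s, (0, 0)) = g (s, (0, 0))"
      using fg(3) by (cases s) (simp_all add: cell_values_def vec_eq_iff forall_3)
    with fg(1,2) show "f v = g v"
      unfolding v bloch_space_iff_origin by metis
  qed
  show "cell_values ` bloch_space \<theta> = UNIV"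
  proof (intro equalityI subset_UNIV subsetI)
    fix x :: "complex ^ 3"
    \<comment> \<open>The prescribed cell values are carried to every other cell by the Bloch
      phase.\<close>
    let ?f = "\<lambda>(s, \<beta>). bloch_phase \<theta> \<beta> * (case s of V1 \<Rightarrow> x $ 1 | V2 \<Rightarrow> x $ 2 | V3 \<Rightarrow> x $ 3)"
    have "?f \<in> bloch_space \<theta>" by (simp add: bloch_space_iff_origin)
    moreover have "x = cell_values ?f" by (simp add: cell_values_def vec_eq_iff forall_3)
    ultimately show "x \<in> cell_values ` bloch_space \<theta>" by blast
  qed
qed

lemma laplacian_at:
  "laplacian \<mu> \<gamma> f (V1, \<beta>) = f (V1, \<beta>) - 1 / of_real \<mu> *
    (of_real (\<gamma> 1) * f (V3, \<beta> + \<omega>2) + of_real (\<gamma> 3) * f (V2, \<beta>) +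
     of_real (\<gamma> 4) * f (V3, \<beta> + \<omega>1) + of_real (\<gamma> 6) * f (V2, \<beta> + \<omega>1))"
  "laplacian \<mu> \<gamma> f (V2, \<beta>) = f (V2, \<beta>) - 1 / of_real \<mu> *
    (of_real (\<gamma> 3) * f (V1, \<beta>) + of_real (\<gamma> 5) * f (V3, \<beta> + \<omega>2) +
     of_real (\<gamma> 6) * f (V1, \<beta> - \<omega>1) + of_real (\<gamma> 2) * f (V3, \<beta>))"
  "laplacian \<mu> \<gamma> f (V3, \<beta>) = f (V3, \<beta>) - 1 / of_real \<mu> *
    (of_real (\<gamma> 5) * f (V2, \<beta> - \<omega>2) + of_real (\<gamma> 1) * f (V1, \<beta> - \<omega>2) +
     of_real (\<gamma> 2) * f (V2, \<beta>) + of_real (\<gamma> 4) * f (V1, \<beta> - \<omega>1))"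
  using map_edge_weight[of \<gamma> \<beta>] by (simp_all add: laplacian_sum_list add.assoc)

text \<open>The weights are constant along translates, so every term of the neighbour sum picks up
  the same phase. This invariance lets bijectivity on \<open>bloch_space\<close> be tested in
  coordinates.\<close>

lemma laplacian_in_bloch_space:
  assumes "f \<in> bloch_space \<theta>"
  shows "laplacian \<mu> \<gamma> f \<in> bloch_space \<theta>"
  unfolding bloch_space_iff
proof (intro allI)
  fix s \<beta> \<beta>'
  have f: "f (s, \<beta> + \<beta>') = bloch_phase \<theta> \<beta>' * f (s, \<beta>)" for s \<beta>
    using assms unfolding bloch_space_iff by blast
  have plus: "f (s, \<beta> + \<beta>' + \<omega>) = bloch_phase \<theta> \<beta>' * f (s, \<beta> + \<omega>)" for s \<omega>
    using f[of s "\<beta> + \<omega>"] by (simp only: ac_simps)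
  have minus: "f (s, \<beta> + \<beta>' - \<omega>) = bloch_phase \<theta> \<beta>' * f (s, \<beta> - \<omega>)" for s \<omega>
    using plus[of s "- \<omega>"] by simp
  show "laplacian \<mu> \<gamma> f (s, \<beta> + \<beta>') = bloch_phase \<theta> \<beta>' * laplacian \<mu> \<gamma> f (s, \<beta>)"
    by (cases s) (simp_all only: laplacian_at plus minus f, simp_all only: algebra_simps)
qed

text \<open>The Laplacian with \<open>E\<close> already subtracted, in the coordinates
  \<open>cell_values\<close>; \<open>w\<close> and \<open>z\<close> are the phases of the
  translations by \<open>\<omega>1\<close> and \<open>\<omega>2\<close>.\<close>

definition bloch_matrix :: "real \<Rightarrow> (nat \<Rightarrow> real) \<Rightarrow> real \<Rightarrow> complex \<Rightarrow> complex \<Rightarrow> complex ^ 3 ^ 3"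
  where "bloch_matrix \<mu> \<gamma> E w z = vector
    [vector [1 - of_real E, - (of_real (\<gamma> 3) + w * of_real (\<gamma> 6)) / of_real \<mu>,
       - (w * of_real (\<gamma> 4) + z * of_real (\<gamma> 1)) / of_real \<mu>],
     vector [- (of_real (\<gamma> 3) + cnj w * of_real (\<gamma> 6)) / of_real \<mu>, 1 - of_real E,
       - (of_real (\<gamma> 2) + z * of_real (\<gamma> 5)) / of_real \<mu>],
     vector [- (cnj w * of_real (\<gamma> 4) + cnj z * of_real (\<gamma> 1)) / of_real \<mu>,
       - (of_real (\<gamma> 2) + cnj z * of_real (\<gamma> 5)) / of_real \<mu>, 1 - of_real E]]"

lemma cell_values_laplacian:
  assumes "f \<in> bloch_space (\<theta>1, \<theta>2)"
  shows "cell_values (\<lambda>v. laplacian \<mu> \<gamma> f v - of_real E * f v) =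
    bloch_matrix \<mu> \<gamma> E (cis \<theta>1) (cis \<theta>2) *v cell_values f"
  unfolding cell_values_def bloch_matrix_def laplacian_bloch[OF assms]
  by (simp add: vec_eq_iff forall_3 matrix_vector_mult_def sum_3 diff_divide_distrib
      add_divide_distrib ring_distribs)

text \<open>The bijection \<open>cell_values\<close> conjugates the shifted Laplacian to
  multiplication by \<open>bloch_matrix\<close>, so bijectivity on the Bloch space becomes
  invertibility of a matrix.\<close>

lemma mem_spectrum_on_bloch_space_iff:
  "of_real E \<in> spectrum_on (bloch_space (\<theta>1, \<theta>2)) (laplacian \<mu> \<gamma>) \<longleftrightarrow>
    det (bloch_matrix \<mu> \<gamma> E (cis \<theta>1) (cis \<theta>2)) = 0"
proof -
  define S where "S = bloch_space (\<theta>1, \<theta>2)"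
  define A where "A = bloch_matrix \<mu> \<gamma> E (cis \<theta>1) (cis \<theta>2)"
  define T where "T = (\<lambda>f v. laplacian \<mu> \<gamma> f v - of_real E * f v)"
  have bij: "bij_betw cell_values S UNIV"
    unfolding S_def by (rule bij_betw_cell_values)
  have T: "T f \<in> S" if "f \<in> S" for f
    using laplacian_in_bloch_space[OF that[unfolded S_def], of \<mu> \<gamma>] that
    by (simp add: S_def T_def bloch_space_iff algebra_simps)
  have comm: "(cell_values \<circ> T) f = ((*v) A \<circ> cell_values) f" if "f \<in> S" for f
    using cell_values_laplacian that by (simp add: S_def T_def A_def)
  have "bij_betw T S S \<longleftrightarrow> bij_betw (cell_values \<circ> T) S UNIV"
    using T by (intro bij_betw_comp_iff2[OF bij]) blast
  also have "\<dots> \<longleftrightarrow> bij_betw ((*v) A \<circ> cell_values) S UNIV"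
    using comm by (rule bij_betw_cong)
  also have "\<dots> \<longleftrightarrow> bij ((*v) A)"
    by (rule bij_betw_comp_iff[OF bij, symmetric])
  also have "\<dots> \<longleftrightarrow> det A \<noteq> 0"
    using invertible_eq_bij[of A] invertible_det_nz[of A] by simp
  finally show ?thesis
    by (simp add: spectrum_on_def S_def T_def A_def)
qed

text \<open>This is \<open>det (- p - A)\<close> written out, where \<open>A\<close> is the
  Hermitian matrix of edge weights with \<open>\<Delta> = Id - A / \<mu>\<close>. The products
  \<open>\<gamma> 1 * \<gamma> 3 * \<gamma> 5\<close> and
  \<open>\<gamma> 2 * \<gamma> 4 * \<gamma> 6\<close> come from walks around the triangles of the
  two orientations, the cosine terms from walks that end in a translated cell.\<close>

definition secular :: "(nat \<Rightarrow> real) \<Rightarrow> real \<Rightarrow> real \<Rightarrow> real \<Rightarrow> real"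
  where "secular \<gamma> p \<theta>1 \<theta>2 =
    p * ((\<gamma> 1)\<^sup>2 + (\<gamma> 2)\<^sup>2 + (\<gamma> 3)\<^sup>2 + (\<gamma> 4)\<^sup>2 + (\<gamma> 5)\<^sup>2 + (\<gamma> 6)\<^sup>2) - p ^ 3
      - 2 * (\<gamma> 1 * \<gamma> 3 * \<gamma> 5 + \<gamma> 2 * \<gamma> 4 * \<gamma> 6)
    + 2 * (p * \<gamma> 3 * \<gamma> 6 - \<gamma> 2 * \<gamma> 3 * \<gamma> 4 - \<gamma> 1 * \<gamma> 5 * \<gamma> 6) * cos \<theta>1
    + 2 * (p * \<gamma> 2 * \<gamma> 5 - \<gamma> 1 * \<gamma> 2 * \<gamma> 3 - \<gamma> 4 * \<gamma> 5 * \<gamma> 6) * cos \<theta>2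
    + 2 * (p * \<gamma> 1 * \<gamma> 4 - \<gamma> 3 * \<gamma> 4 * \<gamma> 5 - \<gamma> 1 * \<gamma> 2 * \<gamma> 6) * cos (\<theta>1 - \<theta>2)"

lemma det_bloch_matrix:
  assumes "\<mu> \<noteq> 0"
  shows "of_real (\<mu> ^ 3) * det (bloch_matrix \<mu> \<gamma> E (cis \<theta>1) (cis \<theta>2)) =
    of_real (secular \<gamma> (\<mu> * (E - 1)) \<theta>1 \<theta>2)"
proof -
  \<comment> \<open>With the conjugates as separate variables tied only by \<open>w * w' = 1\<close>
    and \<open>z * z' = 1\<close>, the expansion becomes a polynomial identity modulo these two
    relations.\<close>
  define w z w' z' where "w = cis \<theta>1" and "z = cis \<theta>2" and "w' = cnj w" and "z' = cnj z"
  have u: "w * w' = 1" "z * z' = 1"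
    by (simp_all add: w_def z_def w'_def z'_def cis_cnj cis_mult)
  have c: "complex_of_real (cos \<theta>1) = (w + w') / 2" "complex_of_real (cos \<theta>2) = (z + z') / 2"
    "complex_of_real (cos (\<theta>1 - \<theta>2)) = (w * z' + w' * z) / 2"
    by (simp_all add: w_def z_def w'_def z'_def complex_eq_iff cos_diff)
  define M L where "M = complex_of_real \<mu>" and "L = complex_of_real (\<mu> * (1 - E))"
  define g where "g k = complex_of_real (\<gamma> k)" for k
  have M: "M \<noteq> 0" using assms by (simp add: M_def)
  have E: "1 - complex_of_real E = L / M" using assms by (simp add: L_def M_def)
  define p where "p = \<mu> * (E - 1)"
  have p: "complex_of_real p = - L" by (simp add: p_def L_def algebra_simps)
  have "M ^ 3 * det (bloch_matrix \<mu> \<gamma> E w z) =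
      L ^ 3 - L * ((g 3 + w * g 6) * (g 3 + w' * g 6) + (w * g 4 + z * g 1) * (w' * g 4 + z' * g 1)
        + (g 2 + z * g 5) * (g 2 + z' * g 5))
      - (g 3 + w * g 6) * (g 2 + z * g 5) * (w' * g 4 + z' * g 1)
      - (g 3 + w' * g 6) * (g 2 + z' * g 5) * (w * g 4 + z * g 1)"
    using M unfolding bloch_matrix_def E
    by (simp add: det_3 flip: M_def g_def w'_def z'_def)
      (simp add: field_simps power3_eq_cube)
  also have "\<dots> = - L * ((g 1)\<^sup>2 + (g 2)\<^sup>2 + (g 3)\<^sup>2 + (g 4)\<^sup>2 + (g 5)\<^sup>2 + (g 6)\<^sup>2) + L ^ 3
      - 2 * (g 1 * g 3 * g 5 + g 2 * g 4 * g 6)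
      + (- L * g 3 * g 6 - g 2 * g 3 * g 4 - g 1 * g 5 * g 6) * (w + w')
      + (- L * g 2 * g 5 - g 1 * g 2 * g 3 - g 4 * g 5 * g 6) * (z + z')
      + (- L * g 1 * g 4 - g 3 * g 4 * g 5 - g 1 * g 2 * g 6) * (w * z' + w' * z)"
    using u by algebra
  also have "\<dots> = of_real (secular \<gamma> (\<mu> * (E - 1)) \<theta>1 \<theta>2)"
    unfolding p_def[symmetric] secular_def by (simp add: c p g_def field_simps)
  finally show ?thesis by (simp add: M_def w_def z_def)
qed

text \<open>Here \<open>x\<close>, \<open>y\<close>, \<open>t\<close> stand for
  \<open>\<gamma> 2\<close>, \<open>\<gamma> 4\<close>, \<open>\<gamma> 6\<close>, and
  \<open>s - x\<close>, \<open>s - y\<close>, \<open>s - t\<close> for \<open>\<gamma> 5\<close>,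
  \<open>\<gamma> 1\<close>, \<open>\<gamma> 3\<close>. Differences of the equations factor, which
  forces two of the unknowns to coincide; then \<open>p = s\<close>, and the third follows.\<close>

lemma flat_band_equations_imp_constant:
  fixes s p x y t :: real
  assumes pos: "x > 0" "y > 0" "t > 0" "x < s" "y < s" "t < s"
    and t: "p * (s - t) * t = x * (s - t) * y + (s - y) * (s - x) * t"
    and x: "p * x * (s - x) = (s - y) * x * (s - t) + y * (s - x) * t"
    and y: "p * (s - y) * y = (s - t) * y * (s - x) + (s - y) * x * t"
  shows "x = y \<and> y = t"
proof -
  have "p * (s - t) * t > 0"
    unfolding t using pos by (intro add_pos_pos mult_pos_pos) auto
  moreover have "(s - t) * t > 0" using pos by simp
  ultimately have p: "p > 0"
    using pos by (simp add: zero_less_mult_iff)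
  \<comment> \<open>In the difference of two equations both sides contain the difference of the two
    unknowns as a factor.\<close>
  have tx: "(t - x) * (p * (s - t - x) - s * (s - 2 * y)) = 0"
    using t x by (simp add: algebra_simps)
  have xy: "(x - y) * (p * (s - x - y) - s * (s - 2 * t)) = 0"
    using x y by (simp add: algebra_simps)
  have yt: "(y - t) * (p * (s - y - t) - s * (s - 2 * x)) = 0"
    using y t by (simp add: algebra_simps)
  have "t = x \<or> x = y \<or> y = t"
  proof (rule ccontr)
    assume "\<not> ?thesis"
    with tx xy have "p * (s - t - x) = s * (s - 2 * y)" "p * (s - x - y) = s * (s - 2 * t)"
      and "y \<noteq> t"
      by auto
    \<comment> \<open>If all three differ, the cofactors vanish; subtracting two of these relations
      would give \<open>p = - 2 * s\<close>, against \<open>p > 0\<close>.\<close>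
    then have "(y - t) * (p + 2 * s) = 0" by (simp add: algebra_simps)
    with \<open>y \<noteq> t\<close> p pos show False by auto
  qed
  \<comment> \<open>Here \<open>b\<close> is the value shared by two unknowns and \<open>c\<close>
    is the third. The first premise yields \<open>p = s\<close>, which turns the second into
    \<open>s * (b - c)^2 = 0\<close>.\<close>
  moreover have coincide: "b = c"
    if "p * b * (s - b) = s * b * (s - b)" "(b - c) * (p * (s - b - c) - s * (s - 2 * b)) = 0"
      "b > 0" "b < s" for b c
  proof -
    have "p = s" using that by simp
    then have "(b - c) * (s * (b - c)) = 0"
      using that(2) by (simp add: algebra_simps)
    then show "b = c" using that by simp
  qed
  ultimately show ?thesis
  proof (elim disjE)
    assume "t = x"
    then show ?thesis using coincide[of x y] x xy pos by (simp add: algebra_simps)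
  next
    assume "x = y"
    then show ?thesis using coincide[of y t] y yt pos by (simp add: algebra_simps)
  next
    assume "y = t"
    then show ?thesis using coincide[of t x] t tx pos by (simp add: algebra_simps)
  qed
qed

theorem theorem6:
  fixes \<mu> :: real and \<gamma> :: "nat \<Rightarrow> real"
  assumes "\<mu> > 0" and "\<And>k. k \<in> {1..6} \<Longrightarrow> \<gamma> k > 0"
    and "\<gamma> 1 + \<gamma> 3 + \<gamma> 4 + \<gamma> 6 = \<mu>"
    and "\<gamma> 2 + \<gamma> 3 + \<gamma> 5 + \<gamma> 6 = \<mu>"
    and "\<gamma> 1 + \<gamma> 2 + \<gamma> 4 + \<gamma> 5 = \<mu>"
  shows "has_flat_band \<mu> \<gamma> \<longleftrightarrow>
    monomeric \<gamma> \<and>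
    (\<exists>\<alpha> \<beta>. \<alpha> > 0 \<and> \<beta> > 0 \<and> 2 * (\<alpha> + \<beta>) = \<mu> \<and>
      \<gamma> 2 = \<alpha> \<and> \<gamma> 4 = \<alpha> \<and> \<gamma> 6 = \<alpha> \<and> \<gamma> 1 = \<beta> \<and> \<gamma> 3 = \<beta> \<and> \<gamma> 5 = \<beta>)"
proof -
  have det: "det (bloch_matrix \<mu> \<gamma> E (cis \<theta>1) (cis \<theta>2)) = 0 \<longleftrightarrow>
      secular \<gamma> (\<mu> * (E - 1)) \<theta>1 \<theta>2 = 0" for E \<theta>1 \<theta>2
    using det_bloch_matrix[of \<mu> \<gamma> E \<theta>1 \<theta>2] assms(1)
    by (metis less_irrefl mult_eq_0_iff of_real_eq_0_iff power_not_zero)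
  have flat: "has_flat_band \<mu> \<gamma> \<longleftrightarrow> (\<exists>E. \<forall>\<theta>1 \<theta>2. secular \<gamma> (\<mu> * (E - 1)) \<theta>1 \<theta>2 = 0)"
    by (simp add: has_flat_band_def mem_spectrum_on_bloch_space_iff det)
  have pos: "\<gamma> 1 > 0" "\<gamma> 2 > 0" "\<gamma> 3 > 0" "\<gamma> 4 > 0" "\<gamma> 5 > 0" "\<gamma> 6 > 0"
    by (simp_all add: assms(2))
  show ?thesis
  proof
    assume "has_flat_band \<mu> \<gamma>"
    then obtain E where "\<forall>\<theta>1 \<theta>2. secular \<gamma> (\<mu> * (E - 1)) \<theta>1 \<theta>2 = 0"
      unfolding flat by blast
    then obtain p where "\<forall>\<theta>1 \<theta>2. secular \<gamma> p \<theta>1 \<theta>2 = 0" by blast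
    \<comment> \<open>At these four points the three cosines have signs \<open>+++\<close>,
      \<open>-+-\<close>, \<open>+--\<close>, \<open>--+\<close>. Together with the constant these
      sign patterns are linearly independent, so every coefficient vanishes.\<close>
    then have "secular \<gamma> p 0 0 = 0" "secular \<gamma> p pi 0 = 0" "secular \<gamma> p 0 pi = 0"
      "secular \<gamma> p pi pi = 0"
      by blast+
    then have eqs: "p * \<gamma> 3 * \<gamma> 6 = \<gamma> 2 * \<gamma> 3 * \<gamma> 4 + \<gamma> 1 * \<gamma> 5 * \<gamma> 6"
      "p * \<gamma> 2 * \<gamma> 5 = \<gamma> 1 * \<gamma> 2 * \<gamma> 3 + \<gamma> 4 * \<gamma> 5 * \<gamma> 6"
      "p * \<gamma> 1 * \<gamma> 4 = \<gamma> 3 * \<gamma> 4 * \<gamma> 5 + \<gamma> 1 * \<gamma> 2 * \<gamma> 6"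
      by (simp_all add: secular_def)
    define s where "s = \<mu> / 2"
    have g: "\<gamma> 1 = s - \<gamma> 4" "\<gamma> 3 = s - \<gamma> 6" "\<gamma> 5 = s - \<gamma> 2"
      using assms(3-5) by (simp_all add: s_def)
    have "\<gamma> 2 = \<gamma> 4 \<and> \<gamma> 4 = \<gamma> 6"
      using flat_band_equations_imp_constant[of "\<gamma> 2" "\<gamma> 4" "\<gamma> 6" s p] eqs pos
      unfolding g by simp
    \<comment> \<open>The list matches the premises of \<open>constant_imp_monomeric\<close> with
      \<open>\<alpha> = \<gamma> 6\<close> and \<open>\<beta> = s - \<gamma> 6\<close>, hence the
      trivial third equation.\<close>
    then have const: "\<gamma> 2 = \<gamma> 6" "\<gamma> 4 = \<gamma> 6" "\<gamma> 6 = \<gamma> 6"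
      "\<gamma> 1 = s - \<gamma> 6" "\<gamma> 3 = s - \<gamma> 6" "\<gamma> 5 = s - \<gamma> 6"
      using g by simp_all
    moreover have "s - \<gamma> 6 > 0" "2 * (\<gamma> 6 + (s - \<gamma> 6)) = \<mu>"
      using pos(3) const(5) by (simp_all add: s_def)
    ultimately show "monomeric \<gamma> \<and> (\<exists>\<alpha> \<beta>. \<alpha> > 0 \<and> \<beta> > 0 \<and> 2 * (\<alpha> + \<beta>) = \<mu> \<and>
      \<gamma> 2 = \<alpha> \<and> \<gamma> 4 = \<alpha> \<and> \<gamma> 6 = \<alpha> \<and> \<gamma> 1 = \<beta> \<and> \<gamma> 3 = \<beta> \<and> \<gamma> 5 = \<beta>)"
      using constant_imp_monomeric[OF const] pos(6) by blast
  next
    assume "monomeric \<gamma> \<and> (\<exists>\<alpha> \<beta>. \<alpha> > 0 \<and> \<beta> > 0 \<and> 2 * (\<alpha> + \<beta>) = \<mu> \<and>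
      \<gamma> 2 = \<alpha> \<and> \<gamma> 4 = \<alpha> \<and> \<gamma> 6 = \<alpha> \<and> \<gamma> 1 = \<beta> \<and> \<gamma> 3 = \<beta> \<and> \<gamma> 5 = \<beta>)"
    then obtain \<alpha> \<beta> where "\<mu> = 2 * (\<alpha> + \<beta>)" "\<gamma> 2 = \<alpha>" "\<gamma> 4 = \<alpha>" "\<gamma> 6 = \<alpha>"
      "\<gamma> 1 = \<beta>" "\<gamma> 3 = \<beta>" "\<gamma> 5 = \<beta>"
      by auto
    \<comment> \<open>The energy \<open>3 / 2\<close> corresponds to \<open>p = \<mu> / 2\<close>,
      the value forced in the converse direction. Each cosine coefficient is then a multiple of
      \<open>(\<alpha> + \<beta>) * \<alpha> * \<beta> - \<alpha>^2 * \<beta> - \<alpha> * \<beta>^2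
      = 0\<close>.\<close>
    moreover from this have "\<mu> * (3 / 2 - 1) = \<alpha> + \<beta>" by simp
    ultimately have "secular \<gamma> (\<mu> * (3 / 2 - 1)) \<theta>1 \<theta>2 = 0" for \<theta>1 \<theta>2
      by (simp add: secular_def algebra_simps power2_eq_square power3_eq_cube)
    then show "has_flat_band \<mu> \<gamma>"
      unfolding flat by blast
  qed
qed

end
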